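(* Let $R$ be a Dedekind domain and let $I$ be a nonzero ideal of $R$ such that $R/I$ is finite and nontrivial. Then $\omega(G_{R/I})=\chi(G_{R/I})=Q(I)$.
   Context: $G_{R/I}$ is the unitary Cayley graph of $R/I$: vertex set $R/I$, with $a+I$, $b+I$ adjacent iff $a-b+I$ is a unit of $R/I$. $\omega$ and $\chi$ denote clique number and chromatic number. $Q(I)$ is the minimum of $|R/P|$ over all prime ideals $P$ dividing $I$. *)

theory Defs
  imports
    "Graph_Theory.Pair_Digraph"
    "HOL-Algebra.Ring_Divisibility"
    "HOL-Algebra.Ideal_Product"
    "HOL-Algebra.Polynomials"
begin

section \<open>Dedekind domains\<close>

definition fraction :: "('a, 'b) ring_scheme \<Rightarrow> 'a \<Rightarrow> 'a \<Rightarrow> ('a \<times> 'a) set" where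
  "fraction R a s = {(b, t). b \<in> carrier R \<and> t \<in> carrier R - {\<zero>\<^bsub>R\<^esub>} \<and> a \<otimes>\<^bsub>R\<^esub> t = b \<otimes>\<^bsub>R\<^esub> s}"

text \<open>The field of fractions of an integral domain: \<open>fraction R a s\<close> is the class \<open>a/s\<close> of the pair
  \<open>(a, s)\<close>. As in \<^const>\<open>rcoset_mult\<close>, an operation on classes is the union of its
  results over all representatives; these results coincide when \<open>R\<close> is a domain.\<close>

definition frac_field :: "('a, 'b) ring_scheme \<Rightarrow> (('a \<times> 'a) set) ring" where
  "frac_field R =
    \<lparr>carrier = {fraction R a s | a s. a \<in> carrier R \<and> s \<in> carrier R - {\<zero>\<^bsub>R\<^esub>}},
     mult = (\<lambda>U V. \<Union>x\<in>U. \<Union>y\<in>V. fraction R (fst x \<otimes>\<^bsub>R\<^esub> fst y) (snd x \<otimes>\<^bsub>R\<^esub> snd y)),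
     one = fraction R \<one>\<^bsub>R\<^esub> \<one>\<^bsub>R\<^esub>,
     zero = fraction R \<zero>\<^bsub>R\<^esub> \<one>\<^bsub>R\<^esub>,
     add = (\<lambda>U V. \<Union>x\<in>U. \<Union>y\<in>V.
              fraction R ((fst x \<otimes>\<^bsub>R\<^esub> snd y) \<oplus>\<^bsub>R\<^esub> (fst y \<otimes>\<^bsub>R\<^esub> snd x)) (snd x \<otimes>\<^bsub>R\<^esub> snd y))\<rparr>"

definition frac_embed :: "('a, 'b) ring_scheme \<Rightarrow> 'a \<Rightarrow> ('a \<times> 'a) set" where
  "frac_embed R a = fraction R a \<one>\<^bsub>R\<^esub>"

text \<open>Polynomials are coefficient lists with the leading coefficient first, so \<open>hd p = \<one>\<close>
  says that \<open>p\<close> is monic.\<close>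

definition integral_over :: "('a, 'b) ring_scheme \<Rightarrow> 'a set \<Rightarrow> 'a \<Rightarrow> bool" where
  "integral_over K A x \<longleftrightarrow>
    (\<exists>p \<in> carrier (A[X]\<^bsub>K\<^esub>). p \<noteq> [] \<and> hd p = \<one>\<^bsub>K\<^esub> \<and> ring.eval K p x = \<zero>\<^bsub>K\<^esub>)"

text \<open>Fields are allowed as Dedekind domains.\<close>

locale dedekind_domain = noetherian_domain +
  assumes integrally_closed:
      "\<lbrakk>x \<in> carrier (frac_field R);
        integral_over (frac_field R) (frac_embed R ` carrier R) x\<rbrakk>
       \<Longrightarrow> x \<in> frac_embed R ` carrier R"
    and prime_imp_maximal: "\<lbrakk>primeideal P R; P \<noteq> {\<zero>}\<rbrakk> \<Longrightarrow> maximalideal P R"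

text \<open>Divisibility of ideals is divisibility in the monoid \<^const>\<open>ideals_set\<close> of ideals under
  multiplication: \<open>P\<close> divides \<open>I\<close> iff \<open>I = P \<cdot> J\<close> for some ideal \<open>J\<close>. When \<open>R/I\<close> is finite,
  so is \<open>R/P\<close> for each such \<open>P\<close>, hence \<^const>\<open>order\<close> is its true cardinality.\<close>

definition Q_min :: "('a, 'b) ring_scheme \<Rightarrow> 'a set \<Rightarrow> nat" where
  "Q_min R I =
    (LEAST n. \<exists>P. primeideal P R \<and> P divides\<^bsub>ideals_set R\<^esub> I \<and> n = order (R Quot P))"


section \<open>Graphs\<close>

text \<open>As in \<^theory>\<open>Graph_Theory.Pair_Digraph\<close>, an undirected graph is a digraph with a symmetric
  arc relation. The numbers below are meant for finite graphs without loops.\<close>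

definition clique :: "'v pair_pre_digraph \<Rightarrow> 'v set \<Rightarrow> bool" where
  "clique G C \<longleftrightarrow> C \<subseteq> pverts G \<and> (\<forall>u\<in>C. \<forall>v\<in>C. u \<noteq> v \<longrightarrow> (u, v) \<in> parcs G)"

definition clique_number :: "'v pair_pre_digraph \<Rightarrow> nat" where
  "clique_number G = Max {card C | C. clique G C}"

definition proper_colouring :: "'v pair_pre_digraph \<Rightarrow> nat \<Rightarrow> ('v \<Rightarrow> nat) \<Rightarrow> bool" where
  "proper_colouring G k c \<longleftrightarrow>
    c ` pverts G \<subseteq> {..<k} \<and> (\<forall>(u, v) \<in> parcs G. c u \<noteq> c v)"

definition chromatic_number :: "'v pair_pre_digraph \<Rightarrow> nat" where
  "chromatic_number G = (LEAST k. \<exists>c. proper_colouring G k c)"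

definition unitary_cayley_graph :: "('a, 'b) ring_scheme \<Rightarrow> 'a pair_pre_digraph" where
  "unitary_cayley_graph S =
    \<lparr>pverts = carrier S,
     parcs = {(x, y). x \<in> carrier S \<and> y \<in> carrier S \<and> x \<ominus>\<^bsub>S\<^esub> y \<in> Units S}\<rparr>"

end

theory Submission
  imports Defs
begin

text \<open>The primes dividing \<open>I\<close> are the maximal ideals \<open>M\<close> containing \<open>I\<close>; that containing is dividing
  rests on the invertibility of nonzero primes. The class of a vertex modulo one such \<open>M\<close> is a
  proper colouring with \<open>|R/M|\<close> colours, since a unit of \<open>R/I\<close> avoids \<open>M\<close>. Conversely the units of
  \<open>R/I\<close> are the classes avoiding every \<open>M\<close>, so the Chinese remainder theorem extends any clique
  with fewer than \<open>Q(I)\<close> vertices.\<close>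

section \<open>The field of fractions\<close>

text \<open>Dedekind domains are given here by the chain condition, integral closedness and
  maximality of nonzero primes, so the invertibility of primes must be derived. An element
  \<open>b/a\<close> of the inverse of \<open>P\<close> is carried as a pair \<open>a\<close>,
  \<open>b\<close> with \<open>b P\<close> inside \<open>(a)\<close>; the field of fractions enters
  where a monic polynomial is evaluated at \<open>b/a\<close>. In the graph, one \<open>M\<close>
  with \<open>|R/M|\<close> least bounds the colours, while a clique has to be injective modulo all
  \<open>M\<close> at once; adding one vertex at a time turns this into one congruence for each of
  finitely many \<open>M\<close>.\<close>

context domain
begin

lemma fraction_eq_iff:
  assumes "a \<in> carrier R" "b \<in> carrier R" "s \<in> carrier R - {\<zero>}" "t \<in> carrier R - {\<zero>}"
  shows "fraction R a s = fraction R b t \<longleftrightarrow> a \<otimes> t = b \<otimes> s"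
proof
  assume "fraction R a s = fraction R b t"
  moreover have "(a, s) \<in> fraction R a s"
    using assms by (simp add: fraction_def)
  ultimately have "(a, s) \<in> fraction R b t"
    by simp
  then show "a \<otimes> t = b \<otimes> s"
    by (auto simp: fraction_def)
next
  have subset: "fraction R a s \<subseteq> fraction R b t"
    if "a \<in> carrier R" "b \<in> carrier R" "s \<in> carrier R - {\<zero>}" "t \<in> carrier R - {\<zero>}"
      and eq: "a \<otimes> t = b \<otimes> s" for a b s t
  proof
    fix x assume "x \<in> fraction R a s"
    then obtain c u where x: "x = (c, u)" "c \<in> carrier R" "u \<in> carrier R - {\<zero>}" "a \<otimes> u = c \<otimes> s"
      by (auto simp: fraction_def)
    \<comment> \<open>Transitivity needs cancellation: both sides are multiplied by the nonzero
      \<open>s\<close> first.\<close>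
    have "s \<otimes> (b \<otimes> u) = (b \<otimes> s) \<otimes> u"
      using that(1-4) x(2,3) by (elim DiffE) algebra
    also have "\<dots> = (a \<otimes> u) \<otimes> t"
      using that(1-4) x(2,3) unfolding eq[symmetric] by (elim DiffE) algebra
    also have "\<dots> = s \<otimes> (c \<otimes> t)"
      using that(1-4) x(2,3) unfolding x(4) by (elim DiffE) algebra
    finally have "b \<otimes> u = c \<otimes> t"
      using that x m_lcancel by auto
    then show "x \<in> fraction R b t"
      using x by (simp add: fraction_def)
  qed
  assume "a \<otimes> t = b \<otimes> s"
  then show "fraction R a s = fraction R b t"
    using subset[of a b s t] subset[of b a t s] assms by auto
qed

lemma mem_fractionE:
  assumes "x \<in> fraction R a s"
  obtains b t where "x = (b, t)" "b \<in> carrier R" "t \<in> carrier R - {\<zero>}" "a \<otimes> t = b \<otimes> s"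
  using assms by (auto simp: fraction_def)

lemma fraction_nonempty:
  assumes "a \<in> carrier R" "s \<in> carrier R - {\<zero>}"
  shows "fraction R a s \<noteq> {}"
  using assms by (auto simp: fraction_def)

lemma frac_field_carrier:
  "carrier (frac_field R) = {fraction R a s | a s. a \<in> carrier R \<and> s \<in> carrier R - {\<zero>}}"
  by (simp add: frac_field_def)

lemma fraction_closed [intro]:
  "a \<in> carrier R \<Longrightarrow> s \<in> carrier R - {\<zero>} \<Longrightarrow> fraction R a s \<in> carrier (frac_field R)"
  by (auto simp: frac_field_carrier)

lemma frac_fieldE:
  assumes "x \<in> carrier (frac_field R)"
  obtains a s where "x = fraction R a s" "a \<in> carrier R" "s \<in> carrier R" "s \<noteq> \<zero>"
  using assms by (auto simp: frac_field_carrier)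

text \<open>All pairs of representatives yield the same class, and the index sets are nonempty, so
  the union in \<open>frac_field\<close> collapses to that class.\<close>

lemma fraction_mult:
  assumes "a \<in> carrier R" "b \<in> carrier R" "s \<in> carrier R - {\<zero>}" "t \<in> carrier R - {\<zero>}"
  shows "fraction R a s \<otimes>\<^bsub>frac_field R\<^esub> fraction R b t = fraction R (a \<otimes> b) (s \<otimes> t)"
proof -
  have "fraction R (fst x \<otimes> fst y) (snd x \<otimes> snd y) = fraction R (a \<otimes> b) (s \<otimes> t)"
    if x_mem: "x \<in> fraction R a s" and y_mem: "y \<in> fraction R b t" for x y
  proof -
    obtain c u where x: "x = (c, u)" "c \<in> carrier R" "u \<in> carrier R - {\<zero>}" "a \<otimes> u = c \<otimes> s"
      using x_mem by (rule mem_fractionE)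
    obtain d v where y: "y = (d, v)" "d \<in> carrier R" "v \<in> carrier R - {\<zero>}" "b \<otimes> v = d \<otimes> t"
      using y_mem by (rule mem_fractionE)
    have "(c \<otimes> d) \<otimes> (s \<otimes> t) = (c \<otimes> s) \<otimes> (d \<otimes> t)"
      using x(2,3) y(2,3) assms by (elim DiffE) algebra
    also have "\<dots> = (a \<otimes> b) \<otimes> (u \<otimes> v)"
      using x(2,3) y(2,3) assms unfolding x(4)[symmetric] y(4)[symmetric] by (elim DiffE) algebra
    finally show ?thesis
      using x y assms by (simp add: fraction_eq_iff integral_iff)
  qed
  then show ?thesis
    using fraction_nonempty[of a s] fraction_nonempty[of b t] assms
    by (auto simp: frac_field_def)
qed

lemma fraction_add:
  assumes "a \<in> carrier R" "b \<in> carrier R" "s \<in> carrier R - {\<zero>}" "t \<in> carrier R - {\<zero>}"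
  shows "fraction R a s \<oplus>\<^bsub>frac_field R\<^esub> fraction R b t = fraction R (a \<otimes> t \<oplus> b \<otimes> s) (s \<otimes> t)"
proof -
  have "fraction R (fst x \<otimes> snd y \<oplus> fst y \<otimes> snd x) (snd x \<otimes> snd y) = fraction R (a \<otimes> t \<oplus> b \<otimes> s) (s \<otimes> t)"
    if x_mem: "x \<in> fraction R a s" and y_mem: "y \<in> fraction R b t" for x y
  proof -
    obtain c u where x: "x = (c, u)" "c \<in> carrier R" "u \<in> carrier R - {\<zero>}" "a \<otimes> u = c \<otimes> s"
      using x_mem by (rule mem_fractionE)
    obtain d v where y: "y = (d, v)" "d \<in> carrier R" "v \<in> carrier R - {\<zero>}" "b \<otimes> v = d \<otimes> t"
      using y_mem by (rule mem_fractionE)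
    have "(c \<otimes> v \<oplus> d \<otimes> u) \<otimes> (s \<otimes> t) = (c \<otimes> s) \<otimes> (v \<otimes> t) \<oplus> (d \<otimes> t) \<otimes> (u \<otimes> s)"
      using x(2,3) y(2,3) assms by (elim DiffE) algebra
    also have "\<dots> = (a \<otimes> t \<oplus> b \<otimes> s) \<otimes> (u \<otimes> v)"
      using x(2,3) y(2,3) assms unfolding x(4)[symmetric] y(4)[symmetric] by (elim DiffE) algebra
    finally show ?thesis
      using x y assms by (simp add: fraction_eq_iff integral_iff)
  qed
  then show ?thesis
    using fraction_nonempty[of a s] fraction_nonempty[of b t] assms
    by (auto simp: frac_field_def)
qed

lemma frac_field_one: "\<one>\<^bsub>frac_field R\<^esub> = fraction R \<one> \<one>"
  and frac_field_zero: "\<zero>\<^bsub>frac_field R\<^esub> = fraction R \<zero> \<one>"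
  by (simp_all add: frac_field_def)

lemma frac_field_cring: "cring (frac_field R)"
proof (rule cringI)
  let ?K = "frac_field R"
  show "abelian_group ?K"
  proof (rule abelian_groupI)
    fix x y z assume xyz: "x \<in> carrier ?K" "y \<in> carrier ?K" "z \<in> carrier ?K"
    obtain a s where x: "x = fraction R a s" "a \<in> carrier R" "s \<in> carrier R" "s \<noteq> \<zero>"
      using xyz(1) by (rule frac_fieldE)
    obtain b t where y: "y = fraction R b t" "b \<in> carrier R" "t \<in> carrier R" "t \<noteq> \<zero>"
      using xyz(2) by (rule frac_fieldE)
    obtain c u where z: "z = fraction R c u" "c \<in> carrier R" "u \<in> carrier R" "u \<noteq> \<zero>"
      using xyz(3) by (rule frac_fieldE)
    have "((a \<otimes> t \<oplus> b \<otimes> s) \<otimes> u \<oplus> c \<otimes> (s \<otimes> t)) \<otimes> (s \<otimes> (t \<otimes> u)) =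
      (a \<otimes> (t \<otimes> u) \<oplus> (b \<otimes> u \<oplus> c \<otimes> t) \<otimes> s) \<otimes> (s \<otimes> t \<otimes> u)"
      using x(2,3) y(2,3) z(2,3) by algebra
    then show "(x \<oplus>\<^bsub>?K\<^esub> y) \<oplus>\<^bsub>?K\<^esub> z = x \<oplus>\<^bsub>?K\<^esub> (y \<oplus>\<^bsub>?K\<^esub> z)"
      using x y z by (simp add: fraction_add fraction_eq_iff integral_iff)
  next
    fix x y assume xyz: "x \<in> carrier ?K" "y \<in> carrier ?K"
    obtain a s where x: "x = fraction R a s" "a \<in> carrier R" "s \<in> carrier R" "s \<noteq> \<zero>"
      using xyz(1) by (rule frac_fieldE)
    obtain b t where y: "y = fraction R b t" "b \<in> carrier R" "t \<in> carrier R" "t \<noteq> \<zero>"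
      using xyz(2) by (rule frac_fieldE)
    show "x \<oplus>\<^bsub>?K\<^esub> y \<in> carrier ?K"
      using x y by (auto simp: fraction_add integral_iff)
    have "(a \<otimes> t \<oplus> b \<otimes> s) \<otimes> (t \<otimes> s) = (b \<otimes> s \<oplus> a \<otimes> t) \<otimes> (s \<otimes> t)"
      using x(2,3) y(2,3) by algebra
    then show "x \<oplus>\<^bsub>?K\<^esub> y = y \<oplus>\<^bsub>?K\<^esub> x"
      using x y by (simp add: fraction_add fraction_eq_iff integral_iff)
  next
    show "\<zero>\<^bsub>?K\<^esub> \<in> carrier ?K"
      by (auto simp: frac_field_zero)
  next
    fix x assume "x \<in> carrier ?K"
    then obtain a s where x: "x = fraction R a s" "a \<in> carrier R" "s \<in> carrier R" "s \<noteq> \<zero>"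
      by (rule frac_fieldE)
    show "\<zero>\<^bsub>?K\<^esub> \<oplus>\<^bsub>?K\<^esub> x = x"
      using x by (simp add: fraction_add frac_field_zero)
    have "(\<ominus> a) \<otimes> s \<oplus> a \<otimes> s = \<zero>"
      using x(2,3) by algebra
    then have "fraction R (\<ominus> a) s \<oplus>\<^bsub>?K\<^esub> x = \<zero>\<^bsub>?K\<^esub>"
      using x by (simp add: fraction_add frac_field_zero fraction_eq_iff integral_iff)
    moreover have "fraction R (\<ominus> a) s \<in> carrier ?K"
      using x by auto
    ultimately show "\<exists>y\<in>carrier ?K. y \<oplus>\<^bsub>?K\<^esub> x = \<zero>\<^bsub>?K\<^esub>"
      by blast
  qed
  show "comm_monoid ?K"
  proof (rule comm_monoidI)
    fix x y assume xyz: "x \<in> carrier ?K" "y \<in> carrier ?K"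
    obtain a s where x: "x = fraction R a s" "a \<in> carrier R" "s \<in> carrier R" "s \<noteq> \<zero>"
      using xyz(1) by (rule frac_fieldE)
    obtain b t where y: "y = fraction R b t" "b \<in> carrier R" "t \<in> carrier R" "t \<noteq> \<zero>"
      using xyz(2) by (rule frac_fieldE)
    show "x \<otimes>\<^bsub>?K\<^esub> y \<in> carrier ?K"
      using x y by (auto simp: fraction_mult integral_iff)
    show "x \<otimes>\<^bsub>?K\<^esub> y = y \<otimes>\<^bsub>?K\<^esub> x"
      using x y by (simp add: fraction_mult m_comm)
  next
    fix x y z assume xyz: "x \<in> carrier ?K" "y \<in> carrier ?K" "z \<in> carrier ?K"
    then show "(x \<otimes>\<^bsub>?K\<^esub> y) \<otimes>\<^bsub>?K\<^esub> z = x \<otimes>\<^bsub>?K\<^esub> (y \<otimes>\<^bsub>?K\<^esub> z)"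
      by (elim frac_fieldE) (simp add: fraction_mult m_assoc integral_iff)
  next
    show "\<one>\<^bsub>?K\<^esub> \<in> carrier ?K"
      by (auto simp: frac_field_one)
  next
    fix x assume "x \<in> carrier ?K"
    then show "\<one>\<^bsub>?K\<^esub> \<otimes>\<^bsub>?K\<^esub> x = x"
      by (elim frac_fieldE) (simp add: fraction_mult frac_field_one)
  qed
  fix x y z assume xyz: "x \<in> carrier ?K" "y \<in> carrier ?K" "z \<in> carrier ?K"
  obtain a s where x: "x = fraction R a s" "a \<in> carrier R" "s \<in> carrier R" "s \<noteq> \<zero>"
    using xyz(1) by (rule frac_fieldE)
  obtain b t where y: "y = fraction R b t" "b \<in> carrier R" "t \<in> carrier R" "t \<noteq> \<zero>"
    using xyz(2) by (rule frac_fieldE)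
  obtain c u where z: "z = fraction R c u" "c \<in> carrier R" "u \<in> carrier R" "u \<noteq> \<zero>"
    using xyz(3) by (rule frac_fieldE)
  have "(a \<otimes> t \<oplus> b \<otimes> s) \<otimes> c \<otimes> (s \<otimes> u \<otimes> (t \<otimes> u)) =
    (a \<otimes> c \<otimes> (t \<otimes> u) \<oplus> b \<otimes> c \<otimes> (s \<otimes> u)) \<otimes> (s \<otimes> t \<otimes> u)"
    using x(2,3) y(2,3) z(2,3) by algebra
  then show "(x \<oplus>\<^bsub>?K\<^esub> y) \<otimes>\<^bsub>?K\<^esub> z = x \<otimes>\<^bsub>?K\<^esub> z \<oplus>\<^bsub>?K\<^esub> y \<otimes>\<^bsub>?K\<^esub> z"
    using x y z by (simp add: fraction_add fraction_mult fraction_eq_iff integral_iff)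
qed

lemma frac_embed_add:
  "a \<in> carrier R \<Longrightarrow> b \<in> carrier R \<Longrightarrow>
    frac_embed R a \<oplus>\<^bsub>frac_field R\<^esub> frac_embed R b = frac_embed R (a \<oplus> b)"
  by (simp add: frac_embed_def fraction_add)

lemma frac_embed_mult:
  "a \<in> carrier R \<Longrightarrow> b \<in> carrier R \<Longrightarrow>
    frac_embed R a \<otimes>\<^bsub>frac_field R\<^esub> frac_embed R b = frac_embed R (a \<otimes> b)"
  by (simp add: frac_embed_def fraction_mult)

lemma frac_embed_closed [simp]: "a \<in> carrier R \<Longrightarrow> frac_embed R a \<in> carrier (frac_field R)"
  by (auto simp: frac_embed_def)

lemma frac_embed_mult_eq_zero:
  assumes "c \<in> carrier R - {\<zero>}" "z \<in> carrier (frac_field R)"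
    and "frac_embed R c \<otimes>\<^bsub>frac_field R\<^esub> z = \<zero>\<^bsub>frac_field R\<^esub>"
  shows "z = \<zero>\<^bsub>frac_field R\<^esub>"
  using assms
  by (elim frac_fieldE) (auto simp: frac_embed_def fraction_mult frac_field_zero fraction_eq_iff integral_iff)

text \<open>The sum \<open>r\<^sub>0 y\<^sub>m \<oplus> r\<^sub>1 y\<^sub>m\<^sub>-\<^sub>1 \<oplus> \<dots>\<close> with indices counted as in
  \<^const>\<open>eval\<close>: if \<open>y\<^sub>i = c x\<^sup>i\<close>, then it is \<open>c\<close> times the value at \<open>x\<close> of the polynomial
  with coefficient list \<open>rs\<close>.\<close>

fun linear_comb :: "(nat \<Rightarrow> 'a) \<Rightarrow> 'a list \<Rightarrow> 'a" where
  "linear_comb y [] = \<zero>"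
| "linear_comb y (r # rs) = r \<otimes> y (length rs) \<oplus> linear_comb y rs"

lemma linear_comb_closed:
  "range y \<subseteq> carrier R \<Longrightarrow> set rs \<subseteq> carrier R \<Longrightarrow> linear_comb y rs \<in> carrier R"
  by (induction rs) (auto simp: image_subset_iff)

text \<open>The factor \<open>y 0\<close> clears denominators: \<open>step\<close> forces
  \<open>x^n y 0 = y n\<close>, so a linear relation between the \<open>y n\<close> in
  \<open>R\<close> becomes a polynomial equation for \<open>x\<close>.\<close>

lemma frac_embed_mult_eval:
  assumes y: "range y \<subseteq> carrier R" and x: "x \<in> carrier (frac_field R)"
    and step: "\<And>n. x \<otimes>\<^bsub>frac_field R\<^esub> frac_embed R (y n) = frac_embed R (y (Suc n))"
    and rs: "set rs \<subseteq> carrier R"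
  shows "frac_embed R (y 0) \<otimes>\<^bsub>frac_field R\<^esub> ring.eval (frac_field R) (map (frac_embed R) rs) x
    = frac_embed R (linear_comb y rs)"
proof -
  interpret K: cring "frac_field R"
    by (rule frac_field_cring)
  have y': "y n \<in> carrier R" for n
    using y by auto
  have pow: "x [^]\<^bsub>frac_field R\<^esub> n \<otimes>\<^bsub>frac_field R\<^esub> frac_embed R (y 0) = frac_embed R (y n)" for n :: nat
  proof (induction n)
    case (Suc n)
    have "x [^]\<^bsub>frac_field R\<^esub> Suc n \<otimes>\<^bsub>frac_field R\<^esub> frac_embed R (y 0)
      = x \<otimes>\<^bsub>frac_field R\<^esub> (x [^]\<^bsub>frac_field R\<^esub> n \<otimes>\<^bsub>frac_field R\<^esub> frac_embed R (y 0))"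
      using x y' by (simp add: K.m_ac)
    then show ?case
      using Suc step by simp
  qed (use y' in simp)
  show ?thesis
    using rs
  proof (induction rs)
    case Nil
    then show ?case
      using y' by (simp add: frac_embed_def frac_field_zero fraction_mult)
  next
    case (Cons r rs)
    define e where "e = K.eval (map (frac_embed R) rs) x"
    have e: "e \<in> carrier (frac_field R)"
      unfolding e_def using Cons.prems x by (intro K.eval_in_carrier) auto
    have "frac_embed R (y 0) \<otimes>\<^bsub>frac_field R\<^esub> K.eval (map (frac_embed R) (r # rs)) x
      = frac_embed R r \<otimes>\<^bsub>frac_field R\<^esub> (x [^]\<^bsub>frac_field R\<^esub> length rs \<otimes>\<^bsub>frac_field R\<^esub> frac_embed R (y 0))
        \<oplus>\<^bsub>frac_field R\<^esub> frac_embed R (y 0) \<otimes>\<^bsub>frac_field R\<^esub> e"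
      using x y' e Cons.prems by (simp add: K.r_distr K.m_ac flip: e_def)
    also have "\<dots> = frac_embed R (linear_comb y (r # rs))"
      using Cons y' linear_comb_closed[OF y] by (simp add: pow frac_embed_mult frac_embed_add e_def)
    finally show ?case .
  qed
qed

end

section \<open>Invertibility of nonzero primes\<close>

context cring
begin

lemma mem_ideal_add_PIdl_iff:
  "y \<in> I <+> PIdl x \<longleftrightarrow> (\<exists>i\<in>I. \<exists>s\<in>carrier R. y = i \<oplus> s \<otimes> x)"
  by (auto simp: set_add_def' cgenideal_def)

lemma
  assumes "ideal I R" "x \<in> carrier R"
  shows subset_ideal_add_PIdl: "I \<subseteq> I <+> PIdl x"
    and self_mem_ideal_add_PIdl: "x \<in> I <+> PIdl x"
proof -
  interpret I: ideal I R
    by (rule assms)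
  have "i = i \<oplus> \<zero> \<otimes> x" if "i \<in> I" for i
    using that assms by simp
  then show "I \<subseteq> I <+> PIdl x"
    unfolding mem_ideal_add_PIdl_iff subset_iff by blast
  show "x \<in> I <+> PIdl x"
    unfolding mem_ideal_add_PIdl_iff
    by (rule bexI[of _ "\<zero>"], rule bexI[of _ "\<one>"]) (use assms in simp_all)
qed

text \<open>The ideal \<open>M + (x)\<close> strictly contains \<open>M\<close>, so it is the whole
  ring; \<open>s\<close> is an inverse of \<open>x\<close> modulo \<open>M\<close>.\<close>

lemma maximalideal_add_PIdl:
  assumes "maximalideal M R" "x \<in> carrier R" "x \<notin> M"
  obtains m s where "m \<in> M" "s \<in> carrier R" "\<one> = m \<oplus> s \<otimes> x"
proof -
  interpret M: maximalideal M R
    by (rule assms)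
  have "ideal (M <+> PIdl x) R"
    using assms by (intro add_ideals cgenideal_ideal M.is_ideal)
  then have "M <+> PIdl x = carrier R"
    using M.I_maximal[of "M <+>\<^bsub>R\<^esub> PIdl x"] ideal.Icarr[of "M <+>\<^bsub>R\<^esub> PIdl x"] assms
      subset_ideal_add_PIdl[OF M.is_ideal assms(2)] self_mem_ideal_add_PIdl[OF M.is_ideal assms(2)]
    by blast
  then show thesis
    using that one_closed mem_ideal_add_PIdl_iff by blast
qed

end

text \<open>Zorn's lemma applies because a nonempty chain of ideals contains its union. The family
  \<open>S\<close> is arbitrary since it serves twice: for proper ideals above \<open>I\<close> and
  for ideals \<open>((a) : b)\<close> inside a prime.\<close>

lemma (in noetherian_ring) exists_maximal_ideal_in:
  assumes "S \<noteq> {}" "S \<subseteq> {I. ideal I R}"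
  obtains M where "M \<in> S" "\<And>J. J \<in> S \<Longrightarrow> M \<subseteq> J \<Longrightarrow> J = M"
proof -
  have "\<Union>C \<in> S" if "C \<noteq> {}" "subset.chain S C" for C
    using that assms ideal_chain_is_trivial[of C] unfolding pred_on.chain_def by blast
  then show thesis
    using subset_Zorn_nonempty[of S] assms(1) that by (smt (verit))
qed

lemma (in noetherian_ring) exists_maximalideal:
  assumes "ideal I R" "I \<noteq> carrier R"
  obtains M where "maximalideal M R" "I \<subseteq> M"
proof -
  let ?S = "{J. ideal J R \<and> I \<subseteq> J \<and> J \<noteq> carrier R}"
  have "?S \<noteq> {}" "?S \<subseteq> {I. ideal I R}"
    using assms by auto
  then obtain M where M: "M \<in> ?S" "\<And>J. J \<in> ?S \<Longrightarrow> M \<subseteq> J \<Longrightarrow> J = M"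
    by (rule exists_maximal_ideal_in) blast
  have "maximalideal M R"
    using M by (intro maximalidealI) blast+
  then show thesis
    using M(1) that by blast
qed

text \<open>The ideals generated by initial segments of \<open>y\<close> form an ascending chain.\<close>

lemma (in noetherian_domain) eventually_linear_comb:
  assumes y: "range y \<subseteq> carrier R"
  obtains rs where "set rs \<subseteq> carrier R" "y (length rs) = linear_comb y rs"
proof -
  \<comment> \<open>\<open>L n\<close> is generated by the \<open>n\<close> elements
    \<open>y 0\<close> to \<open>y (n - 1)\<close>, so \<open>y n\<close> first appears as a
    generator of \<open>L (Suc n)\<close>.\<close>
  define L where "L n = rec_nat {\<zero>} (\<lambda>n J. PIdl (y n) <+> J) n" for n
  have L_0: "L 0 = {\<zero>}" and L_Suc: "L (Suc n) = PIdl (y n) <+> L n" for n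
    by (simp_all add: L_def)
  have y': "y n \<in> carrier R" for n
    using y by auto
  have ideal_L: "ideal (L n) R" for n
    by (induction n) (auto simp: L_0 L_Suc zeroideal cgenideal_ideal y' intro!: add_ideals)
  have zero_L: "\<zero> \<in> L n" and L_carr: "L n \<subseteq> carrier R" for n
    using ideal_L[of n] ideal.Icarr by (auto simp: additive_subgroup.zero_closed ideal.axioms(1))
  have zero_PIdl: "\<zero> \<in> PIdl (y n)" for n
    using cgenideal_ideal[OF y', of n] by (simp add: additive_subgroup.zero_closed ideal.axioms(1))
  have y_L: "y n \<in> L (Suc n)" for n
    using cgenideal_self[OF y', of n] zero_L[of n] y'[of n]
    by (force simp: L_Suc set_add_def')
  have "L n \<subseteq> L (Suc n)" for n
  proof
    fix x assume "x \<in> L n"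
    then have "x = \<zero> \<oplus> x" "x \<in> L n"
      using L_carr[of n] by auto
    then show "x \<in> L (Suc n)"
      using zero_PIdl unfolding L_Suc set_add_def' by blast
  qed
  then have "m \<le> n \<Longrightarrow> L m \<subseteq> L n" for m n
    by (rule lift_Suc_mono_le)
  then have "L m \<subseteq> L n \<or> L n \<subseteq> L m" for m n
    using nat_le_linear[of m n] by blast
  then have "subset.chain {I. ideal I R} (range L)"
    using ideal_L unfolding pred_on.chain_def by blast
  then have "\<Union>(range L) \<in> range L"
    by (intro ideal_chain_is_trivial) auto
  then obtain n where "\<Union>(range L) = L n"
    by auto
  then have "y n \<in> L n"
    using y_L by blast
  \<comment> \<open>The coefficient of the last generator becomes the head of the list, as in
    \<open>linear_comb\<close>; length \<open>n\<close> makes \<open>y n\<close> the term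
    \<open>y (length rs)\<close>.\<close>
  moreover have "\<exists>rs. length rs = n \<and> set rs \<subseteq> carrier R \<and> z = linear_comb y rs" if "z \<in> L n" for n z
    using that
  proof (induction n arbitrary: z)
    case 0
    then show ?case
      by (simp add: L_0)
  next
    case (Suc n)
    then obtain r w where r: "r \<in> carrier R" and w: "w \<in> L n" and z: "z = r \<otimes> y n \<oplus> w"
      by (auto simp: L_Suc set_add_def' cgenideal_def)
    obtain rs where "length rs = n" "set rs \<subseteq> carrier R" "w = linear_comb y rs"
      using Suc.IH[OF w] by blast
    then show ?case
      using r z by (intro exI[of _ "r # rs"]) simp
  qed
  ultimately show thesis
    using that by blast
qed

section \<open>From integral closedness to inverses of primes\<close>

context dedekind_domain
begin

text \<open>If \<open>x = b/a\<close> maps \<open>P\<close> into itself and \<open>c \<in> P\<close> is nonzero, then every \<open>c x\<^sup>n\<close> lies in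
  \<open>R\<close>, and the chain condition for the ideals \<open>(c, c x, \<dots>, c x\<^sup>n)\<close> shows that \<open>x\<close> is integral.\<close>

lemma dvd_if_stabilizes_ideal:
  assumes P: "ideal P R" "P \<noteq> {\<zero>}"
    and a: "a \<in> carrier R - {\<zero>}" and b: "b \<in> carrier R"
    and stable: "\<And>p. p \<in> P \<Longrightarrow> \<exists>q\<in>P. b \<otimes> p = a \<otimes> q"
  shows "b \<in> PIdl a"
proof -
  interpret P: ideal P R
    by (rule P(1))
  interpret K: cring "frac_field R"
    by (rule frac_field_cring)
  obtain c where c: "c \<in> P" "c \<noteq> \<zero>"
    using P(2) P.zero_closed by blast
  \<comment> \<open>\<open>f\<close> is multiplication by \<open>b/a\<close> on \<open>P\<close>, so
    \<open>y n\<close> below is \<open>c x^n\<close> with \<open>x = b/a\<close>.\<close>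
  obtain f where f: "\<And>p. p \<in> P \<Longrightarrow> f p \<in> P" "\<And>p. p \<in> P \<Longrightarrow> b \<otimes> p = a \<otimes> f p"
    using stable by metis
  define y where "y n = (f ^^ n) c" for n
  have y_P: "y n \<in> P" for n
    by (induction n) (auto simp: y_def c f)
  then have y: "range y \<subseteq> carrier R"
    by (auto simp: P.Icarr)
  obtain rs where rs: "set rs \<subseteq> carrier R" "y (length rs) = linear_comb y rs"
    using eventually_linear_comb[OF y] .
  define x where "x = fraction R b a"
  have x: "x \<in> carrier (frac_field R)"
    using a b by (auto simp: x_def)
  have step: "x \<otimes>\<^bsub>frac_field R\<^esub> frac_embed R (y n) = frac_embed R (y (Suc n))" for n
  proof -
    have "y (Suc n) = f (y n)"
      by (simp add: y_def)
    then have "b \<otimes> y n = y (Suc n) \<otimes> a"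
      using f(1)[OF y_P, of n] f(2)[OF y_P, of n] a P.Icarr m_comm[of a "f (y n)"] by simp
    then show ?thesis
      using a b y_P P.Icarr by (simp add: x_def frac_embed_def fraction_mult fraction_eq_iff)
  qed
  \<comment> \<open>The relation \<open>y (length rs) = linear_comb y rs\<close> is moved to one
    side: \<open>p\<close> is monic of degree \<open>length rs\<close>, and
    \<open>linear_comb y p\<close> is \<open>c\<close> times its value at \<open>x\<close>.\<close>
  define p where "p = \<one> # map (\<lambda>r. \<ominus> r) rs"
  have p_carr: "set p \<subseteq> carrier R"
    using rs(1) by (auto simp: p_def)
  have "linear_comb y (map (\<lambda>r. \<ominus> r) ss) = \<ominus> linear_comb y ss" if "set ss \<subseteq> carrier R" for ss
    using that y_P P.Icarr linear_comb_closed[OF y]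
    by (induction ss) (auto simp: l_minus minus_add a_comm)
  then have "linear_comb y p = \<zero>"
    using rs y_P P.Icarr linear_comb_closed[OF y, of rs] by (simp add: p_def r_neg)
  then have "frac_embed R (y 0) \<otimes>\<^bsub>frac_field R\<^esub> K.eval (map (frac_embed R) p) x = \<zero>\<^bsub>frac_field R\<^esub>"
    using frac_embed_mult_eval[OF y x step p_carr] by (simp add: frac_embed_def frac_field_zero)
  moreover have "K.eval (map (frac_embed R) p) x \<in> carrier (frac_field R)"
    using p_carr x by (intro K.eval_in_carrier) auto
  moreover have "y 0 \<in> carrier R - {\<zero>}"
    using c P.Icarr[of c] by (simp add: y_def)
  ultimately have "K.eval (map (frac_embed R) p) x = \<zero>\<^bsub>frac_field R\<^esub>"
    using frac_embed_mult_eq_zero by blast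
  moreover have "polynomial\<^bsub>frac_field R\<^esub> (frac_embed R ` carrier R) (map (frac_embed R) p)"
    using p_carr by (auto simp: polynomial_def p_def frac_embed_def frac_field_zero fraction_eq_iff)
  moreover have "hd (map (frac_embed R) p) = \<one>\<^bsub>frac_field R\<^esub>"
    by (simp add: p_def frac_embed_def frac_field_one)
  ultimately have "integral_over (frac_field R) (frac_embed R ` carrier R) x"
    unfolding integral_over_def univ_poly_def
    by (intro bexI[of _ "map (frac_embed R) p"]) (auto simp: p_def)
  then obtain r where r: "r \<in> carrier R" "x = frac_embed R r"
    using integrally_closed[OF x] by blast
  then have "b = r \<otimes> a"
    using a b by (simp add: x_def frac_embed_def fraction_eq_iff)
  then show ?thesis
    using r by (auto simp: cgenideal_def)
qed

text \<open>A nonzero prime is an associated prime of \<open>R/(a)\<close> for every nonzero \<open>a\<close> in it: among the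
  ideals \<open>((a) : b)\<close> contained in \<open>P\<close>, a maximal one is prime, hence maximal, hence equal to \<open>P\<close>.\<close>

lemma primeideal_associated:
  assumes P: "primeideal P R" and a: "a \<in> P" "a \<noteq> \<zero>"
  obtains b where "b \<in> carrier R" "b \<notin> PIdl a" "\<And>p. p \<in> P \<Longrightarrow> b \<otimes> p \<in> PIdl a"
proof -
  interpret P: primeideal P R
    by (rule P)
  have a_carr: "a \<in> carrier R"
    using a P.Icarr by blast
  interpret A: ideal "PIdl a" R
    by (rule cgenideal_ideal[OF a_carr])
  define ann where "ann b = {x \<in> carrier R. b \<otimes> x \<in> PIdl a}" for b
  have ideal_ann: "ideal (ann b) R" if b: "b \<in> carrier R" for b
  proof (rule idealI)
    show "ring R"
      by (rule ring_axioms)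
    show "subgroup (ann b) (add_monoid R)"
    proof (rule add.subgroupI)
      show "ann b \<noteq> {}"
        using b A.zero_closed by (auto simp: ann_def intro!: exI[of _ \<zero>])
    qed (use b A.a_closed A.a_inv_closed in \<open>auto simp: ann_def r_minus r_distr\<close>)
    fix u x assume "u \<in> ann b" "x \<in> carrier R"
    then show "x \<otimes> u \<in> ann b" "u \<otimes> x \<in> ann b"
      using b A.I_r_closed[of "b \<otimes> u" x] by (auto simp: ann_def m_ac)
  qed
  let ?S = "{ann b | b. b \<in> carrier R \<and> ann b \<subseteq> P}"
  have "ann \<one> \<subseteq> P"
    using cgenideal_minimal[OF P.is_ideal a(1)] by (auto simp: ann_def)
  then have "?S \<noteq> {}" "?S \<subseteq> {I. ideal I R}"
    using ideal_ann by auto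
  then obtain M where "M \<in> ?S" and max: "\<And>J. J \<in> ?S \<Longrightarrow> M \<subseteq> J \<Longrightarrow> J = M"
    by (rule exists_maximal_ideal_in) blast
  then obtain b where b: "b \<in> carrier R" "ann b \<subseteq> P" and M: "M = ann b"
    by blast
  \<comment> \<open>\<open>ann b\<close> lies in every \<open>ann (b \<otimes> z)\<close>, so
    maximality forces equality once the latter stays inside \<open>P\<close>.\<close>
  have max: "ann (b \<otimes> z) = ann b" if z: "z \<in> carrier R" "ann (b \<otimes> z) \<subseteq> P" for z
  proof (rule max[unfolded M])
    show "ann (b \<otimes> z) \<in> ?S"
      using b z by blast
    show "ann b \<subseteq> ann (b \<otimes> z)"
    proof
      fix x assume x: "x \<in> ann b"
      then have "b \<otimes> z \<otimes> x = z \<otimes> (b \<otimes> x)"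
        using b z by (auto simp: ann_def m_ac)
      then show "x \<in> ann (b \<otimes> z)"
        using x z A.I_l_closed[of "b \<otimes> x" z] by (auto simp: ann_def)
    qed
  qed
  have ann_mult: "x \<in> ann (b \<otimes> z) \<longleftrightarrow> z \<otimes> x \<in> ann b" if "x \<in> carrier R" "z \<in> carrier R" for x z
    using that b by (simp add: ann_def m_assoc)
  have "primeideal (ann b) R"
  proof (rule primeidealI)
    show "ideal (ann b) R" "cring R"
      using ideal_ann b cring_axioms by auto
    show "carrier R \<noteq> ann b"
      using b(2) P.I_notcarr P.Icarr by blast
    fix x y assume xy: "x \<in> carrier R" "y \<in> carrier R" "x \<otimes> y \<in> ann b"
    \<comment> \<open>If \<open>ann (b \<otimes> y)\<close> stays inside \<open>P\<close>, it equals
      \<open>ann b\<close> and contains \<open>x\<close>. Otherwise it has an element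
      \<open>z\<close> outside \<open>P\<close>; primality of \<open>P\<close> keeps
      \<open>ann (b \<otimes> z)\<close> inside \<open>P\<close>, so it equals \<open>ann b\<close>,
      and it contains \<open>y\<close>.\<close>
    show "x \<in> ann b \<or> y \<in> ann b"
    proof (cases "ann (b \<otimes> y) \<subseteq> P")
      case True
      then show ?thesis
        using max[of y] ann_mult[of x y] xy m_comm[of x y] by auto
    next
      case False
      then obtain z where z: "z \<in> carrier R" "z \<notin> P" "y \<otimes> z \<in> ann b"
        using ann_mult[of _ y] xy by (auto simp: ann_def)
      have "ann (b \<otimes> z) \<subseteq> P"
      proof
        fix w assume w: "w \<in> ann (b \<otimes> z)"
        then have w_carr: "w \<in> carrier R"
          by (simp add: ann_def)
        then have "z \<otimes> w \<in> P"
          using w z ann_mult b(2) by blast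
        then show "w \<in> P"
          using P.I_prime z w_carr by blast
      qed
      then show ?thesis
        using max[of z] ann_mult[of y z] z xy m_comm[of y z] by auto
    qed
  qed
  moreover have "a \<in> ann b"
    using a_carr b cgenideal_self[OF a_carr] A.I_l_closed by (auto simp: ann_def)
  ultimately have "maximalideal (ann b) R"
    using a(2) prime_imp_maximal by blast
  then have P_eq: "P = ann b"
    using maximalideal.I_maximal[OF _ P.is_ideal b(2)] P.I_notcarr P.Icarr by blast
  have "b \<notin> PIdl a"
  proof
    assume "b \<in> PIdl a"
    then have "\<one> \<in> ann b"
      using b by (simp add: ann_def)
    then show False
      using b(2) P.one_imp_carrier P.I_notcarr by blast
  qed
  then show thesis
    by (rule that[OF b(1)]) (use P_eq ann_def in blast)
qed

text \<open>The element \<open>b/a\<close> lies in \<open>P\<^sup>-\<^sup>1\<close> and multiplies \<open>p\<close> out of \<open>P\<close>, so \<open>P P\<^sup>-\<^sup>1 = R\<close>.\<close>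

lemma primeideal_invertible:
  assumes P: "primeideal P R" "P \<noteq> {\<zero>}"
  obtains a b p r where "a \<in> carrier R - {\<zero>}" "b \<in> carrier R" "p \<in> P" "r \<in> carrier R - P"
    "b \<otimes> p = a \<otimes> r" "\<And>q. q \<in> P \<Longrightarrow> b \<otimes> q \<in> PIdl a"
proof -
  interpret P: primeideal P R
    by (rule P)
  obtain a where a: "a \<in> P" "a \<noteq> \<zero>"
    using P(2) P.zero_closed by blast
  then have a_carr: "a \<in> carrier R - {\<zero>}"
    using P.Icarr by blast
  obtain b where b: "b \<in> carrier R" "b \<notin> PIdl a" "\<And>p. p \<in> P \<Longrightarrow> b \<otimes> p \<in> PIdl a"
    using primeideal_associated[OF P(1) a] by blast
  \<comment> \<open>As \<open>b/a\<close> is not in \<open>R\<close>, it cannot map \<open>P\<close>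
    into itself; the image of this \<open>p\<close> is the \<open>r\<close> outside
    \<open>P\<close>.\<close>
  obtain p where p: "p \<in> P" "\<not> (\<exists>q\<in>P. b \<otimes> p = a \<otimes> q)"
    using dvd_if_stabilizes_ideal[OF P.is_ideal P(2) a_carr b(1)] b(2) by blast
  obtain r where "r \<in> carrier R" "b \<otimes> p = a \<otimes> r"
    using b(3)[OF p(1)] a_carr by (auto simp: cgenideal_def m_comm)
  then show thesis
    using that[of a b p r] a_carr b p by blast
qed

text \<open>The cofactor is the ideal quotient \<open>J = (I : P)\<close>, in the role of
  \<open>I P^-1\<close>. From \<open>1 = q + s r\<close> with \<open>r = p (b/a)\<close>, each
  \<open>i\<close> in \<open>I\<close> equals \<open>q i + (s p) (i b/a)\<close>, where
  \<open>q\<close>, \<open>s p\<close> lie in \<open>P\<close> and \<open>i\<close>,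
  \<open>i b/a\<close> in \<open>J\<close>.\<close>

lemma primeideal_divides_iff_subset:
  assumes P: "primeideal P R" and I: "ideal I R" "I \<noteq> {\<zero>}"
  shows "P divides\<^bsub>ideals_set R\<^esub> I \<longleftrightarrow> I \<subseteq> P"
proof
  assume "P divides\<^bsub>ideals_set R\<^esub> I"
  then show "I \<subseteq> P"
    using ideal_prod_inter[OF primeideal.axioms(1)[OF P]] by (auto simp: factor_def ideals_set_def)
next
  assume "I \<subseteq> P"
  interpret P: primeideal P R
    by (rule P)
  interpret I: ideal I R
    by (rule I(1))
  have P0: "P \<noteq> {\<zero>}"
    using \<open>I \<subseteq> P\<close> I(2) I.zero_closed by blast
  define J where "J = {x \<in> carrier R. \<forall>p\<in>P. x \<otimes> p \<in> I}"
  have "ideal J R"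
  proof (rule idealI)
    show "ring R"
      by (rule ring_axioms)
    show "subgroup J (add_monoid R)"
    proof (rule add.subgroupI)
      show "J \<noteq> {}"
        using I.zero_closed P.Icarr by (auto simp: J_def intro!: exI[of _ \<zero>])
    qed (use P.Icarr in \<open>auto simp: J_def l_minus l_distr\<close>)
    fix u x assume "u \<in> J" "x \<in> carrier R"
    then show "x \<otimes> u \<in> J" "u \<otimes> x \<in> J"
      using P.Icarr I.I_l_closed[of _ x] by (auto simp: J_def m_assoc m_comm[of u x])
  qed
  have "ideal_prod R P J \<subseteq> I"
  proof
    fix x assume "x \<in> ideal_prod R P J"
    then show "x \<in> I"
      by (induction rule: ideal_prod.induct) (auto simp: J_def m_comm P.Icarr)
  qed
  moreover have "I \<subseteq> ideal_prod R P J"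
  proof
    fix i assume i: "i \<in> I"
    obtain a b p r where abpr: "a \<in> carrier R - {\<zero>}" "b \<in> carrier R" "p \<in> P" "r \<in> carrier R - P"
      "b \<otimes> p = a \<otimes> r" and bP: "\<And>q. q \<in> P \<Longrightarrow> b \<otimes> q \<in> PIdl a"
      using primeideal_invertible[OF P P0] by blast
    then obtain q s where qs: "q \<in> P" "s \<in> carrier R" "\<one> = q \<oplus> s \<otimes> r"
      using maximalideal_add_PIdl[OF prime_imp_maximal[OF P P0], of r] by blast
    have carr: "i \<in> carrier R" "q \<in> carrier R" "s \<in> carrier R" "r \<in> carrier R" "p \<in> carrier R" "a \<in> carrier R"
      using i qs abpr I.Icarr P.Icarr by auto
    \<comment> \<open>\<open>j\<close> is \<open>i b/a\<close>, which lies in \<open>R\<close>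
      because \<open>i\<close> lies in \<open>P\<close>.\<close>
    obtain j where j: "j \<in> carrier R" "b \<otimes> i = a \<otimes> j"
      using bP[of i] i \<open>I \<subseteq> P\<close> carr by (auto simp: cgenideal_def m_comm)
    have "j \<in> J"
    proof -
      \<comment> \<open>The factor \<open>b/a\<close> is shifted from \<open>i\<close> to
        \<open>x\<close>: \<open>d = x b/a\<close> lies in \<open>R\<close>, so
        \<open>j x = i d\<close> stays in \<open>I\<close>.\<close>
      have "j \<otimes> x \<in> I" if x: "x \<in> P" for x
      proof -
        obtain d where d: "d \<in> carrier R" "b \<otimes> x = a \<otimes> d"
          using bP[OF x] carr by (auto simp: cgenideal_def m_comm)
        have x_carr: "x \<in> carrier R"
          using x P.Icarr by blast
        have "a \<otimes> (j \<otimes> x) = (b \<otimes> i) \<otimes> x"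
          using j carr x_carr by (simp add: m_assoc)
        also have "\<dots> = (b \<otimes> x) \<otimes> i"
          using abpr carr x_carr by (simp add: m_ac)
        also have "\<dots> = a \<otimes> (i \<otimes> d)"
          using d carr by (simp add: m_ac)
        finally have "j \<otimes> x = i \<otimes> d"
          using abpr j d carr x_carr m_lcancel by auto
        then show ?thesis
          using I.I_r_closed i d by simp
      qed
      then show ?thesis
        using j by (simp add: J_def)
    qed
    have "a \<otimes> (p \<otimes> j) = (b \<otimes> i) \<otimes> p"
      using j carr by (simp add: m_ac)
    also have "\<dots> = (b \<otimes> p) \<otimes> i"
      using abpr(2) carr by (simp add: m_ac)
    also have "\<dots> = a \<otimes> (r \<otimes> i)"
      using abpr(5) carr by (simp add: m_ac)
    finally have pj: "p \<otimes> j = r \<otimes> i"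
      using abpr j carr m_lcancel by auto
    have "i = (q \<oplus> s \<otimes> r) \<otimes> i"
      using carr by (simp flip: qs(3))
    also have "\<dots> = q \<otimes> i \<oplus> s \<otimes> (r \<otimes> i)"
      using carr by algebra
    also have "\<dots> = q \<otimes> i \<oplus> (s \<otimes> p) \<otimes> j"
      using carr j by (simp add: m_assoc flip: pj)
    finally have eq: "i = q \<otimes> i \<oplus> (s \<otimes> p) \<otimes> j" .
    have "i \<in> J"
      using i P.Icarr I.I_r_closed by (auto simp: J_def I.Icarr)
    moreover have "s \<otimes> p \<in> P"
      using abpr carr P.I_l_closed by blast
    ultimately have "q \<otimes> i \<oplus> (s \<otimes> p) \<otimes> j \<in> ideal_prod R P J"
      using qs(1) \<open>j \<in> J\<close> by (intro ideal_prod.sum ideal_prod.prod)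
    then show "i \<in> ideal_prod R P J"
      using eq by simp
  qed
  ultimately show "P divides\<^bsub>ideals_set R\<^esub> I"
    using \<open>ideal J R\<close> by (auto simp: factor_def ideals_set_def)
qed

end

section \<open>Cliques and colourings of unitary Cayley graphs\<close>

lemma card_clique_le_colours:
  assumes "clique G C" "proper_colouring G k c"
  shows "card C \<le> k"
proof -
  have "inj_on c C"
  proof (rule inj_onI, rule ccontr)
    fix u v assume "u \<in> C" "v \<in> C" "c u = c v" "u \<noteq> v"
    then show False
      using assms unfolding clique_def proper_colouring_def by blast
  qed
  moreover have "c ` C \<subseteq> {..<k}"
    using assms unfolding clique_def proper_colouring_def by blast
  ultimately show ?thesis
    using card_inj_on_le[of c C "{..<k}"] by simp
qed

text \<open>A clique and a colouring of equal size certify each other: the colours bound every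
  clique from above, the clique bounds every number of colours from below.\<close>

lemma clique_number_chromatic_number_eqI:
  assumes clique: "clique G C" and colouring: "proper_colouring G (card C) c"
  shows "clique_number G = card C" "chromatic_number G = card C"
proof -
  have "{card D | D. clique G D} \<subseteq> {..card C}"
    using card_clique_le_colours[OF _ colouring] by auto
  then show "clique_number G = card C"
    unfolding clique_number_def using clique by (intro Max_eqI finite_subset[OF _ finite_atMost]) auto
  show "chromatic_number G = card C"
    unfolding chromatic_number_def using clique colouring card_clique_le_colours
    by (intro Least_equality) auto
qed

section \<open>Cosets of an ideal and the ideals above it\<close>

context ideal
begin

lemma Quot_carrier: "carrier (R Quot I) = (+>) I ` carrier R"
  by (auto simp: FactRing_def A_RCOSETS_def')

lemma Quot_minus:
  assumes "x \<in> carrier R" "y \<in> carrier R"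
  shows "(I +> x) \<ominus>\<^bsub>R Quot I\<^esub> (I +> y) = I +> (x \<ominus> y)"
proof -
  interpret hom: ring_hom_ring R "R Quot I" "(+>) I"
    by (rule rcos_ring_hom_ring)
  show ?thesis
    using assms by (simp add: a_minus_def)
qed

lemma a_r_coset_eq_iff:
  assumes "x \<in> carrier R" "y \<in> carrier R"
  shows "I +> x = I +> y \<longleftrightarrow> x \<ominus> y \<in> I"
  using quotient_eq_iff_same_a_r_cos[OF is_ideal assms] by auto

text \<open>Vertices are cosets of \<open>I\<close>; reducing a vertex \<open>A\<close> modulo an
  ideal \<open>J\<close> above \<open>I\<close> is written \<open>J +> coset_rep A\<close>.
  Representatives of \<open>A\<close> differ by elements of \<open>I\<close>, so the choice does not
  affect the class.\<close>

definition coset_rep :: "'a set \<Rightarrow> 'a" where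
  "coset_rep A = (SOME x. x \<in> carrier R \<and> A = I +> x)"

lemma coset_rep:
  assumes "A \<in> carrier (R Quot I)"
  shows "coset_rep A \<in> carrier R" "I +> coset_rep A = A"
proof -
  have "\<exists>x. x \<in> carrier R \<and> A = I +> x"
    using assms by (auto simp: Quot_carrier)
  from someI_ex[OF this] show "coset_rep A \<in> carrier R" "I +> coset_rep A = A"
    unfolding coset_rep_def by simp_all
qed

lemma coset_rep_diff:
  assumes "x \<in> carrier R"
  shows "coset_rep (I +> x) \<ominus> x \<in> I"
  using coset_rep[of "I +> x"] assms by (auto simp: Quot_carrier simp flip: a_r_coset_eq_iff)

lemma Quot_carrier_image:
  assumes "ideal J R" "I \<subseteq> J"
  shows "carrier (R Quot J) = (\<lambda>A. J +> coset_rep A) ` carrier (R Quot I)"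
proof -
  interpret J: ideal J R
    by (rule assms)
  have "J +> coset_rep (I +> x) = J +> x" if "x \<in> carrier R" for x
    using that coset_rep_diff[of x] coset_rep[of "I +> x"] assms(2)
    by (subst J.a_r_coset_eq_iff) (auto simp: Quot_carrier)
  then show ?thesis
    by (force simp: J.Quot_carrier Quot_carrier image_image)
qed

text \<open>An ideal above \<open>I\<close> is the union of the cosets of \<open>I\<close> that it
  contains, hence determined by a subset of \<open>R/I\<close>. This supplies the finiteness for the
  Chinese remainder theorem.\<close>

lemma finite_ideals_above:
  assumes "finite (carrier (R Quot I))"
  shows "finite {J. ideal J R \<and> I \<subseteq> J}"
proof (rule finite_subset)
  show "{J. ideal J R \<and> I \<subseteq> J} \<subseteq> Union ` Pow (carrier (R Quot I))"
  proof
    fix J assume "J \<in> {J. ideal J R \<and> I \<subseteq> J}"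
    then interpret J: ideal J R
      by simp
    have IJ: "I \<subseteq> J"
      using \<open>J \<in> _\<close> by simp
    have "\<Union>((+>) I ` J) = J"
      using IJ J.Icarr a_rcos_self by (auto simp: a_r_coset_def')
    then show "J \<in> Union ` Pow (carrier (R Quot I))"
      using J.Icarr by (intro image_eqI[of _ _ "(+>) I ` J"]) (auto simp: Quot_carrier)
  qed
qed (use assms in simp)

end

section \<open>Chinese remainder theorem for maximal ideals, and units modulo
  \<open>I\<close>\<close>

context cring
begin

text \<open>\<open>e\<close> is a product with one factor \<open>s m\<close> for each
  \<open>M\<close> in \<open>F\<close>: distinct maximal ideals are not nested, so some
  \<open>m\<close> in \<open>M\<close> lies outside \<open>N\<close> and has an inverse
  \<open>s\<close> modulo \<open>N\<close>.\<close>

lemma maximalideals_coprime: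
  assumes "finite F" "\<And>M. M \<in> F \<Longrightarrow> maximalideal M R" "maximalideal N R" "N \<notin> F"
  shows "\<exists>e\<in>carrier R. (\<forall>M\<in>F. e \<in> M) \<and> \<one> \<ominus> e \<in> N"
  using assms
proof (induction F)
  case empty
  interpret N: maximalideal N R
    by fact
  show ?case
    by (intro bexI[of _ \<one>]) (auto simp: a_minus_def r_neg)
next
  case (insert M F)
  interpret N: maximalideal N R
    by fact
  interpret M: maximalideal M R
    using insert by simp
  obtain e where e: "e \<in> carrier R" "\<And>M. M \<in> F \<Longrightarrow> e \<in> M" "\<one> \<ominus> e \<in> N"
    using insert by auto
  have "\<not> M \<subseteq> N"
    using insert M.I_maximal[OF N.is_ideal] N.I_notcarr N.Icarr by blast
  then obtain m where m: "m \<in> M" "m \<notin> N"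
    by blast
  then obtain n s where ns: "n \<in> N" "s \<in> carrier R" "\<one> = n \<oplus> s \<otimes> m"
    using maximalideal_add_PIdl[OF insert.prems(2), of m] M.Icarr by blast
  have carr: "n \<in> carrier R" "m \<in> carrier R"
    using ns m N.Icarr M.Icarr by auto
  \<comment> \<open>Both \<open>e\<close> and \<open>s m\<close> are 1 modulo \<open>N\<close>; the
    identity expresses the defect of their product by their own defects.\<close>
  have "\<one> \<ominus> e \<otimes> (s \<otimes> m) = (\<one> \<ominus> e) \<otimes> (s \<otimes> m) \<oplus> (\<one> \<ominus> s \<otimes> m)"
    using e carr ns(2) by algebra
  also have "\<one> \<ominus> s \<otimes> m = n"
    using carr ns(2) unfolding ns(3) by algebra
  finally have "\<one> \<ominus> e \<otimes> (s \<otimes> m) \<in> N"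
    using e ns carr N.I_r_closed by auto
  moreover have "e \<otimes> (s \<otimes> m) \<in> K" if "K \<in> insert M F" for K
  proof -
    interpret K: maximalideal K R
      using insert that by auto
    show ?thesis
      using that e carr ns m by (auto simp: K.I_r_closed M.I_l_closed)
  qed
  ultimately show ?case
    using e carr ns by (intro bexI[of _ "e \<otimes> (s \<otimes> m)"]) auto
qed

lemma chinese_remainder_maximalideals:
  assumes "finite F" "\<And>M. M \<in> F \<Longrightarrow> maximalideal M R" "\<And>M. M \<in> F \<Longrightarrow> f M \<in> carrier R"
  shows "\<exists>x\<in>carrier R. \<forall>M\<in>F. M +> x = M +> f M"
  using assms
proof (induction F)
  case empty
  show ?case
    by auto
next
  case (insert N F)
  interpret N: maximalideal N R
    using insert by simp
  obtain x where x: "x \<in> carrier R" "\<And>M. M \<in> F \<Longrightarrow> M +> x = M +> f M"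
    using insert by auto
  obtain e where e: "e \<in> carrier R" "\<And>M. M \<in> F \<Longrightarrow> e \<in> M" "\<one> \<ominus> e \<in> N"
    using maximalideals_coprime[of F N] insert by auto
  \<comment> \<open>The correction vanishes modulo every member of \<open>F\<close>, where
    \<open>x\<close> is already right, and is \<open>f N - x\<close> modulo
    \<open>N\<close>.\<close>
  define z where "z = x \<oplus> e \<otimes> (f N \<ominus> x)"
  have z: "z \<in> carrier R"
    using x e insert by (simp add: z_def)
  have "z \<ominus> f N = (\<one> \<ominus> e) \<otimes> (x \<ominus> f N)"
    using x e insert(5)[of N] unfolding z_def by (simp, algebra)
  then have "N +> z = N +> f N"
    using N.I_r_closed[OF e(3), of "x \<ominus> f N"] x z insert by (simp add: N.a_r_coset_eq_iff)
  moreover have "M +> z = M +> f M" if M: "M \<in> F" for M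
  proof -
    interpret M: maximalideal M R
      using insert M by simp
    have "z \<ominus> x = e \<otimes> (f N \<ominus> x)"
      using x e insert(5)[of N] unfolding z_def by (simp, algebra)
    then have "M +> z = M +> x"
      using M.I_r_closed[OF e(2)[OF M], of "f N \<ominus> x"] x z insert by (simp add: M.a_r_coset_eq_iff)
    then show ?thesis
      using x M by simp
  qed
  ultimately show ?case
    using z by auto
qed

lemma rcos_Units_notin:
  assumes "ideal I R" "maximalideal M R" "I \<subseteq> M" "x \<in> carrier R" "I +> x \<in> Units (R Quot I)"
  shows "x \<notin> M"
proof
  assume "x \<in> M"
  interpret I: ideal I R
    by fact
  interpret M: maximalideal M R
    by fact
  obtain B where B: "B \<in> carrier (R Quot I)" "B \<otimes>\<^bsub>R Quot I\<^esub> (I +> x) = \<one>\<^bsub>R Quot I\<^esub>"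
    using assms(5) by (auto simp: Units_def)
  then obtain y where y: "y \<in> carrier R" "B = I +> y"
    by (auto simp: I.Quot_carrier)
  then have "I +> (y \<otimes> x) = I +> \<one>"
    using B assms(4) by (simp add: FactRing_def I.rcoset_mult_add)
  then have "\<one> \<ominus> y \<otimes> x \<in> M"
    using assms(3,4) y I.a_r_coset_eq_iff[of \<one> "y \<otimes> x"] by auto
  moreover have "\<one> = (\<one> \<ominus> y \<otimes> x) \<oplus> y \<otimes> x"
    using y(1) assms(4) by algebra
  ultimately have "\<one> \<in> M"
    using M.a_closed[of "\<one> \<ominus> y \<otimes> x" "y \<otimes> x"] M.I_l_closed[OF \<open>x \<in> M\<close> y(1)] by simp
  then show False
    using M.one_imp_carrier M.I_notcarr by simp
qed

end

lemma (in cring) exists_colouring_Quot: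
  assumes I: "ideal I R" and M: "maximalideal M R" "I \<subseteq> M" and fin: "finite (carrier (R Quot I))"
  shows "\<exists>c. proper_colouring (unitary_cayley_graph (R Quot I)) (order (R Quot M)) c"
proof -
  interpret I: ideal I R
    by (rule I)
  interpret M: maximalideal M R
    by (rule M(1))
  have image: "carrier (R Quot M) = (\<lambda>A. M +> I.coset_rep A) ` carrier (R Quot I)"
    by (rule I.Quot_carrier_image[OF M.is_ideal M(2)])
  then have "finite (carrier (R Quot M))"
    using fin by simp
  \<comment> \<open>\<open>g\<close> numbers the cosets of \<open>M\<close>, as colours are natural
    numbers below the bound.\<close>
  then obtain g where g: "bij_betw g (carrier (R Quot M)) {..<order (R Quot M)}"
    using ex_bij_betw_finite_nat by (auto simp: order_def lessThan_atLeast0)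
  have "proper_colouring (unitary_cayley_graph (R Quot I)) (order (R Quot M))
    (\<lambda>A. g (M +> I.coset_rep A))"
    unfolding proper_colouring_def
  proof (intro conjI ballI)
    show "(\<lambda>A. g (M +> I.coset_rep A)) ` pverts (unitary_cayley_graph (R Quot I)) \<subseteq> {..<order (R Quot M)}"
      using bij_betw_imp_surj_on[OF g] by (auto simp: unitary_cayley_graph_def image)
    fix e assume e: "e \<in> parcs (unitary_cayley_graph (R Quot I))"
    obtain A B where AB: "e = (A, B)" "A \<in> carrier (R Quot I)" "B \<in> carrier (R Quot I)"
      "A \<ominus>\<^bsub>R Quot I\<^esub> B \<in> Units (R Quot I)"
      using e by (auto simp: unitary_cayley_graph_def)
    note A = I.coset_rep[OF AB(2)] and B = I.coset_rep[OF AB(3)]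
    have "I +> (I.coset_rep A \<ominus> I.coset_rep B) \<in> Units (R Quot I)"
      using AB(4) I.Quot_minus[OF A(1) B(1)] A B by simp
    then have "I.coset_rep A \<ominus> I.coset_rep B \<notin> M"
      using A B by (intro rcos_Units_notin[OF I M]) auto
    then have "M +> I.coset_rep A \<noteq> M +> I.coset_rep B"
      using A B by (simp add: M.a_r_coset_eq_iff)
    then have "g (M +> I.coset_rep A) \<noteq> g (M +> I.coset_rep B)"
      using bij_betw_imp_inj_on[OF g] AB by (auto simp: image inj_on_eq_iff)
    then show "case e of (A, B) \<Rightarrow> g (M +> I.coset_rep A) \<noteq> g (M +> I.coset_rep B)"
      by (simp add: AB)
  qed
  then show ?thesis
    by blast
qed

context noetherian_domain
begin

text \<open>If \<open>x\<close> avoids all maximal ideals above \<open>I\<close>, none contains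
  \<open>I + (x)\<close>, which is then the whole ring; in \<open>1 = i + s x\<close> the element
  \<open>s\<close> inverts \<open>x\<close> modulo \<open>I\<close>.\<close>

lemma rcos_Units_iff:
  assumes I: "ideal I R" and x: "x \<in> carrier R"
  shows "I +> x \<in> Units (R Quot I) \<longleftrightarrow> (\<forall>M. maximalideal M R \<and> I \<subseteq> M \<longrightarrow> x \<notin> M)"
proof
  assume "I +> x \<in> Units (R Quot I)"
  then show "\<forall>M. maximalideal M R \<and> I \<subseteq> M \<longrightarrow> x \<notin> M"
    using rcos_Units_notin[OF I _ _ x] by blast
next
  interpret I: ideal I R
    by (rule I)
  assume notin: "\<forall>M. maximalideal M R \<and> I \<subseteq> M \<longrightarrow> x \<notin> M"
  have "I <+> PIdl x = carrier R"
  proof (rule ccontr)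
    assume "I <+> PIdl x \<noteq> carrier R"
    then obtain M where M: "maximalideal M R" "I <+>\<^bsub>R\<^esub> PIdl x \<subseteq> M"
      using exists_maximalideal[OF add_ideals[OF I cgenideal_ideal[OF x]]] by blast
    then show False
      using M notin subset_ideal_add_PIdl[OF I x] self_mem_ideal_add_PIdl[OF I x] by blast
  qed
  then have "\<one> \<in> I <+> PIdl x"
    by simp
  then obtain i s where i: "i \<in> I" "s \<in> carrier R" "\<one> = i \<oplus> s \<otimes> x"
    unfolding mem_ideal_add_PIdl_iff by blast
  have "\<one> \<ominus> s \<otimes> x = i"
    using i(2) I.Icarr[OF i(1)] x unfolding i(3) by algebra
  then have "I +> (s \<otimes> x) = I +> \<one>"
    using i x I.a_r_coset_eq_iff[of \<one> "s \<otimes> x"] by auto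
  then have "(I +> s) \<otimes>\<^bsub>R Quot I\<^esub> (I +> x) = \<one>\<^bsub>R Quot I\<^esub>" "(I +> x) \<otimes>\<^bsub>R Quot I\<^esub> (I +> s) = \<one>\<^bsub>R Quot I\<^esub>"
    using i(2) x by (simp_all add: FactRing_def I.rcoset_mult_add m_comm)
  then show "I +> x \<in> Units (R Quot I)"
    using i(2) x by (auto simp: Units_def I.Quot_carrier)
qed

text \<open>A clique smaller than every \<open>|R/M|\<close> extends by a vertex that avoids its classes modulo
  every maximal ideal \<open>M\<close> above \<open>I\<close>.\<close>

lemma exists_clique_Quot:
  assumes I: "ideal I R" "I \<noteq> carrier R" and fin: "finite (carrier (R Quot I))"
    and n: "\<And>M. maximalideal M R \<Longrightarrow> I \<subseteq> M \<Longrightarrow> n \<le> order (R Quot M)"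
  shows "\<exists>C. clique (unitary_cayley_graph (R Quot I)) C \<and> card C = n"
  using n
proof (induction n)
  case 0
  show ?case
    by (auto simp: clique_def intro!: exI[of _ "{}"])
next
  case (Suc n)
  interpret I: ideal I R
    by (rule I)
  obtain C where C: "clique (unitary_cayley_graph (R Quot I)) C" "card C = n"
    using Suc by (meson Suc_leD)
  then have C_carr: "C \<subseteq> carrier (R Quot I)"
    by (simp add: clique_def unitary_cayley_graph_def)
  then have fin_C: "finite C"
    using fin finite_subset by blast
  let ?F = "{M. maximalideal M R \<and> I \<subseteq> M}"
  have fin_F: "finite ?F"
    by (rule finite_subset[OF _ I.finite_ideals_above[OF fin]]) (auto simp: maximalideal.axioms(1))
  \<comment> \<open>The \<open>n\<close> vertices of \<open>C\<close> occupy at most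
    \<open>n\<close> classes modulo \<open>M\<close>, while \<open>R/M\<close> has at least
    \<open>n + 1\<close>, so a class is free.\<close>
  have "\<exists>z\<in>carrier R. \<forall>A\<in>C. M +> z \<noteq> M +> I.coset_rep A" if "M \<in> ?F" for M
  proof -
    interpret M: maximalideal M R
      using that by simp
    have "card ((\<lambda>A. M +> I.coset_rep A) ` C) < card (carrier (R Quot M))"
      using card_image_le[OF fin_C, of "\<lambda>A. M +> I.coset_rep A"] C(2) Suc.prems[of M] that
      by (simp add: order_def)
    then have "\<not> carrier (R Quot M) \<subseteq> (\<lambda>A. M +> I.coset_rep A) ` C"
      using card_mono[of "(\<lambda>A. M +> I.coset_rep A) ` C" "carrier (R Quot M)"] fin_C by fastforce
    then show ?thesis
      by (auto simp: M.Quot_carrier)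
  qed
  then obtain f where f: "\<And>M. M \<in> ?F \<Longrightarrow> f M \<in> carrier R"
    "\<And>M A. M \<in> ?F \<Longrightarrow> A \<in> C \<Longrightarrow> M +> f M \<noteq> M +> I.coset_rep A"
    by metis
  obtain z where z: "z \<in> carrier R" "\<And>M. M \<in> ?F \<Longrightarrow> M +> z = M +> f M"
    using chinese_remainder_maximalideals[of ?F f] fin_F f by blast
  have z_neq: "M +> z \<noteq> M +> I.coset_rep A" if "M \<in> ?F" "A \<in> C" for M A
    using f(2)[OF that] z(2)[OF that(1)] by simp
  have unit: "A \<ominus>\<^bsub>R Quot I\<^esub> (I +> z) \<in> Units (R Quot I)"
    "(I +> z) \<ominus>\<^bsub>R Quot I\<^esub> A \<in> Units (R Quot I)" if A: "A \<in> C" for A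
  proof -
    note rep = I.coset_rep[OF subsetD[OF C_carr A]]
    have "I.coset_rep A \<ominus> z \<notin> M \<and> z \<ominus> I.coset_rep A \<notin> M" if M: "M \<in> ?F" for M
    proof -
      interpret M: maximalideal M R
        using M by simp
      show ?thesis
        using z_neq[OF M A] rep z M.a_r_coset_eq_iff[of z "I.coset_rep A"]
          M.a_r_coset_eq_iff[of "I.coset_rep A" z] by auto
    qed
    then have "I +> (I.coset_rep A \<ominus> z) \<in> Units (R Quot I)" "I +> (z \<ominus> I.coset_rep A) \<in> Units (R Quot I)"
      using rep z by (simp_all add: rcos_Units_iff[OF I(1)])
    then show "A \<ominus>\<^bsub>R Quot I\<^esub> (I +> z) \<in> Units (R Quot I)"
      "(I +> z) \<ominus>\<^bsub>R Quot I\<^esub> A \<in> Units (R Quot I)"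
      using I.Quot_minus[OF rep(1) z(1)] I.Quot_minus[OF z(1) rep(1)] rep by simp_all
  qed
  obtain M where M: "M \<in> ?F"
    using exists_maximalideal[OF I] by blast
  \<comment> \<open>One \<open>M\<close> suffices, and it exists because \<open>I\<close> is proper:
    if the new vertex were in \<open>C\<close>, the class of \<open>z\<close> modulo
    \<open>M\<close> would be one of those avoided.\<close>
  have "I +> z \<notin> C"
  proof
    assume zC: "I +> z \<in> C"
    interpret M: maximalideal M R
      using M by simp
    have "M +> I.coset_rep (I +> z) = M +> z"
      using I.coset_rep_diff[OF z(1)] M z I.coset_rep[OF subsetD[OF C_carr zC]]
      by (subst M.a_r_coset_eq_iff) auto
    then show False
      using z_neq[OF M zC] by simp
  qed
  then have "card (insert (I +> z) C) = Suc n"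
    using fin_C C by simp
  moreover have "clique (unitary_cayley_graph (R Quot I)) (insert (I +> z) C)"
    unfolding clique_def
  proof (intro conjI ballI impI)
    have z_carr: "I +> z \<in> carrier (R Quot I)"
      using z by (simp add: I.Quot_carrier)
    then show "insert (I +> z) C \<subseteq> pverts (unitary_cayley_graph (R Quot I))"
      using C_carr by (simp add: unitary_cayley_graph_def)
    fix A B assume "A \<in> insert (I +> z) C" "B \<in> insert (I +> z) C" "A \<noteq> B"
    then consider "A \<in> C" "B \<in> C" | "A = I +> z" "B \<in> C" | "A \<in> C" "B = I +> z"
      by blast
    then show "(A, B) \<in> parcs (unitary_cayley_graph (R Quot I))"
    proof cases
      case 1
      then show ?thesis
        using C(1) \<open>A \<noteq> B\<close> by (simp add: clique_def)
    qed (use unit z_carr C_carr in \<open>auto simp: unitary_cayley_graph_def\<close>)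
  qed
  ultimately show ?case
    by blast
qed

end

text \<open>A prime dividing the nonzero \<open>I\<close> contains it, so it is nonzero and hence
  maximal. As \<open>I\<close> is proper, such primes exist and the least value in
  \<open>Q_min\<close> is attained.\<close>

lemma (in dedekind_domain) Q_min_properties:
  assumes I: "ideal I R" "I \<noteq> {\<zero>}" "I \<noteq> carrier R"
  shows "\<exists>M. maximalideal M R \<and> I \<subseteq> M \<and> order (R Quot M) = Q_min R I"
    and "\<And>M. maximalideal M R \<Longrightarrow> I \<subseteq> M \<Longrightarrow> Q_min R I \<le> order (R Quot M)"
proof -
  have iff: "primeideal P R \<and> P divides\<^bsub>ideals_set R\<^esub> I \<longleftrightarrow> maximalideal P R \<and> I \<subseteq> P" for P
    using primeideal_divides_iff_subset[OF _ I(1,2), of P] maximalideal_prime[of P]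
      prime_imp_maximal[of P] I(2) additive_subgroup.zero_closed[OF ideal.axioms(1)[OF I(1)]]
    by blast
  have Q: "Q_min R I = (LEAST n. \<exists>M. (maximalideal M R \<and> I \<subseteq> M) \<and> n = order (R Quot M))"
    unfolding Q_min_def conj_assoc[symmetric] iff ..
  obtain M where "maximalideal M R" "I \<subseteq> M"
    using exists_maximalideal[OF I(1,3)] by blast
  then have "\<exists>n M. (maximalideal M R \<and> I \<subseteq> M) \<and> n = order (R Quot M)"
    by blast
  from LeastI_ex[OF this]
  show "\<exists>M. maximalideal M R \<and> I \<subseteq> M \<and> order (R Quot M) = Q_min R I"
    unfolding Q by metis
  show "Q_min R I \<le> order (R Quot M)" if "maximalideal M R" "I \<subseteq> M" for M
    unfolding Q using that by (intro Least_le) blast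
qed

theorem theorem4p3:
  fixes R :: "('a, 'b) ring_scheme" and I :: "'a set"
  assumes "dedekind_domain R"
    and "ideal I R"
    and "I \<noteq> {\<zero>\<^bsub>R\<^esub>}"
    and "finite (carrier (R Quot I))"
    and "carrier (R Quot I) \<noteq> {\<zero>\<^bsub>R Quot I\<^esub>}"
  shows "clique_number (unitary_cayley_graph (R Quot I)) = chromatic_number (unitary_cayley_graph (R Quot I))
       \<and> chromatic_number (unitary_cayley_graph (R Quot I)) = Q_min R I"
proof -
  interpret dedekind_domain R
    by (rule assms)
  interpret I: ideal I R
    by (rule assms)
  have "I \<noteq> carrier R"
  proof
    assume "I = carrier R"
    then have "I +>\<^bsub>R\<^esub> x = I" if "x \<in> carrier R" for x
      using that a_coset_join2[of x I] I.a_subgroup by simp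
    then have "carrier (R Quot I) = {I}"
      by (auto simp: I.Quot_carrier)
    then show False
      using assms(5) by (simp add: FactRing_def)
  qed
  note Q = Q_min_properties[OF assms(2,3) this]
  obtain M where M: "maximalideal M R" "I \<subseteq> M" "order (R Quot M) = Q_min R I"
    using Q(1) by blast
  obtain C where C: "clique (unitary_cayley_graph (R Quot I)) C" "card C = Q_min R I"
    using exists_clique_Quot[OF assms(2) \<open>I \<noteq> carrier R\<close> assms(4) Q(2)] by blast
  obtain c where "proper_colouring (unitary_cayley_graph (R Quot I)) (Q_min R I) c"
    using exists_colouring_Quot[OF assms(2) M(1,2) assms(4)] M(3) by auto
  then show ?thesis
    using clique_number_chromatic_number_eqI[OF C(1)] C(2) by simp
qed

end
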